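(* Let $\lambda$ be a nonzero real number. For all integers $n\ge0$, \[ \beta_{n,\lambda}(x)=\frac{n}{2}\,\mathcal{E}_{n-1,\lambda}(x)+\sum_{k=0}^{n}\binom{n}{k}\beta_{k,\lambda}\,\mathcal{E}_{n-k,\lambda}(x), \] where for $n=0$ the term $\frac{n}{2}\mathcal{E}_{n-1,\lambda}(x)$ is interpreted as $0$.
   Context: For a nonzero real $\lambda$ and any $x$, set $(x)_{0,\lambda}=1$ and $(x)_{n,\lambda}=x(x-\lambda)\cdots(x-(n-1)\lambda)$ for $n\ge1$. The degenerate exponential is $e_{\lambda}^{x}(t)=\sum_{k\ge0}(x)_{k,\lambda}\frac{t^k}{k!}$ ($=(1+\lambda t)^{x/\lambda}$), $e_\lambda(t)=e_\lambda^1(t)$. The degenerate Bernoulli polynomials and degenerate Euler polynomials are defined by $\frac{t}{e_\lambda(t)-1}e_\lambda^x(t)=\sum_{n\ge0}\beta_{n,\lambda}(x)\frac{t^n}{n!}$ and $\frac{2}{e_\lambda(t)+1}e_\lambda^x(t)=\sum_{n\ge0}\mathcal{E}_{n,\lambda}(x)\frac{t^n}{n!}$; the degenerate Bernoulli numbers are $\beta_{n,\lambda}=\beta_{n,\lambda}(0)$. *)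

theory Defs
  imports Complex_Main "HOL-Computational_Algebra.Formal_Power_Series"
begin

text \<open>
  The parameter \<open>l\<close> is real; the argument \<open>x\<close> ranges over an arbitrary
  \<open>real_field\<close>, so that both real and complex \<open>x\<close> are covered.
\<close>

definition degenerate_falling :: "real \<Rightarrow> nat \<Rightarrow> 'a::real_field \<Rightarrow> 'a" where
  "degenerate_falling l n x = (\<Prod>i<n. x - of_nat i * of_real l)"

definition degenerate_exp :: "real \<Rightarrow> 'a::real_field \<Rightarrow> 'a fps" where
  "degenerate_exp l x = Abs_fps (\<lambda>k. degenerate_falling l k x / fact k)"

text \<open>
  The quotient by \<open>degenerate_exp l 1 - 1\<close>, which is not a unit, is the division of
  \<^typ>\<open>'a fps\<close> that cancels the common factor \<open>fps_X\<close>; it is exact by the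
  lemma \<open>degenerate_bernoulli_quotient\<close> below.
\<close>

definition degenerate_bernoulli :: "real \<Rightarrow> nat \<Rightarrow> 'a::real_field \<Rightarrow> 'a" where
  "degenerate_bernoulli l n x =
     fact n * fps_nth (fps_X / (degenerate_exp l 1 - 1) * degenerate_exp l x) n"

definition degenerate_euler :: "real \<Rightarrow> nat \<Rightarrow> 'a::real_field \<Rightarrow> 'a" where
  "degenerate_euler l n x =
     fact n * fps_nth (2 / (degenerate_exp l 1 + 1) * degenerate_exp l x) n"

definition degenerate_bernoulli_number :: "real \<Rightarrow> nat \<Rightarrow> 'a::real_field" where
  "degenerate_bernoulli_number l n = degenerate_bernoulli l n 0"

lemma subdegree_degenerate_exp_minus_1:
  "subdegree (degenerate_exp l 1 - 1 :: 'a::real_field fps) = 1"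
  by (rule subdegreeI) (auto simp: degenerate_exp_def degenerate_falling_def)

lemma degenerate_bernoulli_quotient:
  "fps_X / (degenerate_exp l 1 - 1) * (degenerate_exp l 1 - 1) = (fps_X :: 'a::real_field fps)"
proof -
  have "degenerate_exp l 1 - 1 \<noteq> (0 :: 'a fps)"
    using subdegree_degenerate_exp_minus_1[of l, where 'a = 'a] by auto
  then have "degenerate_exp l 1 - 1 dvd (fps_X :: 'a fps)"
    by (metis fps_dvd_iff fps_X_neq_zero subdegree_fps_X subdegree_degenerate_exp_minus_1 order_refl)
  then show ?thesis by simp
qed

lemma degenerate_euler_quotient:
  "2 / (degenerate_exp l 1 + 1) * (degenerate_exp l 1 + 1) = (2 :: 'a::real_field fps)"
proof -
  have "fps_nth (degenerate_exp l 1 + 1 :: 'a fps) 0 \<noteq> 0"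
    by (simp add: degenerate_exp_def degenerate_falling_def)
  then have "is_unit (degenerate_exp l 1 + 1 :: 'a fps)"
    by simp
  then show ?thesis by (meson unit_imp_dvd dvd_div_mult_self)
qed

end

theory Submission imports Defs begin

text \<open>
  Write \<open>e\<close> for the degenerate exponential, \<open>B = t / (e - 1)\<close> and \<open>E = 2 / (e + 1)\<close>. Then
  \<open>t E + 2 B E = B E (e - 1) + 2 B E = B E (e + 1) = 2 B\<close>. Multiplying by the degenerate
  exponential with exponent \<open>x\<close> and comparing coefficients gives the claim.
\<close>

text \<open>For positive index the factor \<open>i = 0\<close> of the falling product is zero. Hence
  the degenerate Bernoulli numbers are the coefficients of
  \<open>fps_X / (degenerate_exp l 1 - 1)\<close> itself.\<close>

lemma degenerate_exp_0: "degenerate_exp l 0 = 1"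
proof (rule fps_ext)
  fix n
  show "fps_nth (degenerate_exp l (0 :: 'a)) n = fps_nth 1 n"
    by (cases n) (simp_all add: degenerate_exp_def degenerate_falling_def prod.lessThan_Suc_shift
        del: prod.lessThan_Suc)
qed

lemma degenerate_bernoulli_euler_fps:
  fixes l :: real and x :: "'a::real_field"
  defines "e \<equiv> degenerate_exp l (1 :: 'a)"
  shows "2 * (fps_X / (e - 1) * degenerate_exp l x) =
           fps_X * (2 / (e + 1) * degenerate_exp l x) +
           2 * (fps_X / (e - 1) * (2 / (e + 1) * degenerate_exp l x))"
proof -
  define B where "B = fps_X / (e - 1)"
  define E where "E = 2 / (e + 1)"
  have B: "B * (e - 1) = fps_X" and E: "E * (e + 1) = 2"
    unfolding B_def E_def e_def
    by (rule degenerate_bernoulli_quotient, rule degenerate_euler_quotient)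
  have "fps_X * (E * degenerate_exp l x) + 2 * (B * (E * degenerate_exp l x)) =
      B * (E * (e + 1)) * degenerate_exp l x"
    \<comment> \<open>Only the outer \<open>fps_X\<close> becomes \<open>B * (e - 1)\<close>, since
      the one inside \<open>B\<close> is hidden.\<close>
    unfolding B[symmetric] by (simp add: algebra_simps)
  also have "\<dots> = 2 * (B * degenerate_exp l x)"
    unfolding E by (simp add: algebra_simps)
  finally have "2 * (B * degenerate_exp l x) =
      fps_X * (E * degenerate_exp l x) + 2 * (B * (E * degenerate_exp l x))" ..
  then show ?thesis by (simp only: B_def E_def)
qed

theorem theorem2p4:
  fixes l :: real and x :: "'a::real_field" and n :: nat
  assumes "l \<noteq> 0"
  shows "degenerate_bernoulli l n x =
           of_nat n / 2 * degenerate_euler l (n - 1) x +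
           (\<Sum>k=0..n. of_nat (n choose k) * degenerate_bernoulli_number l k *
                     degenerate_euler l (n - k) x)"
proof -
  define B where "B = fps_X / (degenerate_exp l 1 - 1 :: 'a fps)"
  define F where "F = 2 / (degenerate_exp l 1 + 1) * degenerate_exp l x"
  have "fps_nth (2 * (B * degenerate_exp l x)) n = fps_nth (fps_X * F + 2 * (B * F)) n"
    unfolding B_def F_def by (rule arg_cong[OF degenerate_bernoulli_euler_fps])
  then have "fps_nth (B * degenerate_exp l x) n = fps_nth (fps_X * F) n / 2 + fps_nth (B * F) n"
    \<comment> \<open>Read as a constant series, 2 scales each coefficient and can be divided
      out.\<close>
    by (simp only: fps_add_nth numeral_fps_const fps_mult_left_const_nth) (simp add: field_simps)
  then have "degenerate_bernoulli l n x = fact n * fps_nth (fps_X * F) n / 2 + fact n * fps_nth (B * F) n"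
    by (simp add: degenerate_bernoulli_def B_def ring_distribs)
  \<comment> \<open>For \<open>n = 0\<close> both sides vanish: \<open>fps_X * F\<close> has no
    constant term, and \<open>of_nat n\<close> cancels the truncated index
    \<open>n - 1 = 0\<close>.\<close>
  moreover have "fact n * fps_nth (fps_X * F) n = of_nat n * degenerate_euler l (n - 1) x"
    by (cases n) (simp_all add: degenerate_euler_def F_def algebra_simps)
  moreover have "fact n * fps_nth (B * F) n =
      (\<Sum>k=0..n. of_nat (n choose k) * degenerate_bernoulli_number l k * degenerate_euler l (n - k) x)"
    \<comment> \<open>Cauchy product: \<open>fact n\<close> splits termwise as
      \<open>n choose k\<close> times \<open>fact k * fact (n - k)\<close>, which normalises both
      coefficients.\<close>
    unfolding fps_mult_nth sum_distrib_left
    by (rule sum.cong[OF refl])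
      (simp add: degenerate_bernoulli_number_def degenerate_bernoulli_def degenerate_euler_def
        degenerate_exp_0 binomial_fact flip: B_def F_def)
  ultimately show ?thesis by simp
qed

end
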